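(* Let $m,n\ge 2$ be integers, let $a,b,c\in\mathbb{R}$, and let $P$ be the $m\times n$ monic symmetric biquadratic form $$P(\mathbf{x},\mathbf{y})=\sum_{i=1}^m\sum_{j=1}^n x_i^2y_j^2+a\sum_{i\ne k}\sum_{j=1}^n x_ix_ky_j^2+b\sum_{i=1}^m\sum_{j\ne l}x_i^2y_jy_l+c\sum_{i\ne k}\sum_{j\ne l}x_iy_jx_ky_l .$$ Then $P$ is PSD if and only if $a,b,c$ satisfy all of the following: (i) $1-b+(m-1)(a-c)\ge 0$; (ii) $1-a+(n-1)(b-c)\ge 0$; (iii) $1-a-b+c\ge 0$; (iv) $1+(m-1)a+(n-1)b+(m-1)(n-1)c\ge 0$; (v) if $c\ne 0$, $\frac{a}{c}\in[1-n,1)$ and $\frac{b}{c}\in[1-m,1)$, then $1-\frac{ab}{c}\ge 0$.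
   Context: Here $\mathbf{x}=(x_1,\dots,x_m)\in\mathbb{R}^m$ and $\mathbf{y}=(y_1,\dots,y_n)\in\mathbb{R}^n$; the sums over $i\ne k$ run over all ordered pairs $(i,k)$ with $i,k\in\{1,\dots,m\}$, $i\neq k$, and the sums over $j\ne l$ over all ordered pairs $(j,l)$ with $j,l\in\{1,\dots,n\}$, $j\neq l$. $P$ is positive semi-definite (PSD) if $P(\mathbf{x},\mathbf{y})\ge 0$ for all $\mathbf{x}\in\mathbb{R}^m$, $\mathbf{y}\in\mathbb{R}^n$. *)

theory Defs
  imports "HOL-Analysis.Analysis"
begin

text \<open>The sums over \<open>i \<noteq> k\<close> and \<open>j \<noteq> l\<close> range over ordered pairs, so each
  unordered pair of distinct indices is counted twice.\<close>

definition sym_biquad ::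
  "real \<Rightarrow> real \<Rightarrow> real \<Rightarrow> real ^ 'm \<Rightarrow> real ^ 'n \<Rightarrow> real" where
  "sym_biquad a b c x y =
     (\<Sum>i\<in>UNIV. \<Sum>j\<in>UNIV. (x $ i)\<^sup>2 * (y $ j)\<^sup>2)
   + a * (\<Sum>(i, k)\<in>{(i, k). i \<noteq> k}. \<Sum>j\<in>UNIV. x $ i * x $ k * (y $ j)\<^sup>2)
   + b * (\<Sum>i\<in>UNIV. \<Sum>(j, l)\<in>{(j, l). j \<noteq> l}. (x $ i)\<^sup>2 * y $ j * y $ l)
   + c * (\<Sum>(i, k)\<in>{(i, k). i \<noteq> k}. \<Sum>(j, l)\<in>{(j, l). j \<noteq> l}. x $ i * y $ j * x $ k * y $ l)"

definition psd :: "(real ^ 'm \<Rightarrow> real ^ 'n \<Rightarrow> real) \<Rightarrow> bool" where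
  "psd P \<longleftrightarrow> (\<forall>x y. P x y \<ge> 0)"

end

theory Submission
  imports Defs
begin

text \<open>
  The form depends on \<open>x\<close> only through \<open>X = \<Sum>i. x\<^sub>i\<^sup>2\<close> and \<open>s = (\<Sum>i. x\<^sub>i)\<^sup>2\<close>, and on \<open>y\<close>
  only through the analogous \<open>Y\<close> and \<open>t\<close>; its value is
  \<open>X Y + a (s - X) Y + b X (t - Y) + c (s - X) (t - Y)\<close> (lemma \<open>sym_biquad_eq_biquad_of_sums\<close>).
  For nonzero \<open>x\<close> and \<open>y\<close>, \<open>s / X\<close> lies in \<open>[0, m]\<close> and \<open>t / Y\<close> in \<open>[0, n]\<close> by
  Cauchy--Schwarz, so the form divided by \<open>X Y\<close> is the value, at a point of the rectangle
  \<open>[0, m] \<times> [0, n]\<close>, of a function that is affine in each of its two arguments.  Such a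
  function is a weighted mean of its values at the four corners (lemma
  \<open>biquad_of_sums_interpolation\<close>), and those four values are exactly the left-hand sides of
  (i)--(iv); so (i)--(iv) are sufficient.  They are necessary because each corner is attained:
  the all-ones vector has \<open>s / X = m\<close>, the difference of two distinct unit vectors has
  \<open>s / X = 0\<close>, and likewise for \<open>y\<close>.

  Condition (v) follows from (i)--(iv): when \<open>c \<noteq> 0\<close> the function has the single critical point
  \<open>(1 - b / c, 1 - a / c)\<close> with critical value \<open>1 - a b / c\<close>, and the membership hypotheses of
  (v) place this point inside the rectangle.
\<close>

text \<open>
  \<open>X\<close>, \<open>Y\<close> stand for the sums of squares and \<open>s\<close>, \<open>t\<close> for the squared sums of the entries of
  the two vectors; \<open>s - X\<close> and \<open>t - Y\<close> are then the sums of the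
  products of two entries over ordered pairs of distinct indices.
\<close>

definition biquad_of_sums :: "real \<Rightarrow> real \<Rightarrow> real \<Rightarrow> real \<Rightarrow> real \<Rightarrow> real \<Rightarrow> real \<Rightarrow> real" where
  "biquad_of_sums a b c X s Y t = X * Y + a * (s - X) * Y + b * X * (t - Y) + c * (s - X) * (t - Y)"

lemma sum_off_diagonal_products:
  fixes f :: "'a::finite \<Rightarrow> 'b::comm_ring_1"
  shows "(\<Sum>(i, k)\<in>{(i, k). i \<noteq> k}. f i * f k) = (\<Sum>i\<in>UNIV. f i)\<^sup>2 - (\<Sum>i\<in>UNIV. (f i)\<^sup>2)"
proof -
  have "(\<Sum>i\<in>UNIV. f i)\<^sup>2 = (\<Sum>p\<in>UNIV. f (fst p) * f (snd p))"
    by (simp add: power2_eq_square sum_product sum.cartesian_product case_prod_beta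
        flip: UNIV_Times_UNIV)
  also have "\<dots> = (\<Sum>p\<in>{(i, k). i \<noteq> k}. f (fst p) * f (snd p))
      + (\<Sum>p\<in>{(i, k). i = k}. f (fst p) * f (snd p))"
    by (subst sum.union_disjoint[symmetric]) (auto intro!: sum.cong)
  also have "(\<Sum>p\<in>{(i, k). i = k}. f (fst p) * f (snd p)) = (\<Sum>i\<in>UNIV. (f i)\<^sup>2)"
    by (rule sum.reindex_bij_witness[of _ "\<lambda>i. (i, i)" fst]) (auto simp: power2_eq_square)
  finally show ?thesis
    by (simp add: case_prod_unfold)
qed

lemma sym_biquad_eq_biquad_of_sums:
  fixes x :: "real ^ 'm" and y :: "real ^ 'n"
  shows "sym_biquad a b c x y =
    biquad_of_sums a b c (\<Sum>i\<in>UNIV. (x $ i)\<^sup>2) ((\<Sum>i\<in>UNIV. x $ i)\<^sup>2)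
      (\<Sum>j\<in>UNIV. (y $ j)\<^sup>2) ((\<Sum>j\<in>UNIV. y $ j)\<^sup>2)"
proof -
  let ?D = "{(i :: 'm, k). i \<noteq> k}" and ?E = "{(j :: 'n, l). j \<noteq> l}"
  have "(\<Sum>(i, k)\<in>?D. \<Sum>j\<in>UNIV. x $ i * x $ k * (y $ j)\<^sup>2)
      = (\<Sum>(i, k)\<in>?D. x $ i * x $ k) * (\<Sum>j\<in>UNIV. (y $ j)\<^sup>2)"
    by (simp add: sum_product case_prod_beta)
  moreover have "(\<Sum>i\<in>UNIV. \<Sum>(j, l)\<in>?E. (x $ i)\<^sup>2 * y $ j * y $ l)
      = (\<Sum>i\<in>UNIV. (x $ i)\<^sup>2) * (\<Sum>(j, l)\<in>?E. y $ j * y $ l)"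
    by (simp add: sum_product case_prod_beta mult.assoc)
  moreover have "(\<Sum>(i, k)\<in>?D. \<Sum>(j, l)\<in>?E. x $ i * y $ j * x $ k * y $ l)
      = (\<Sum>(i, k)\<in>?D. x $ i * x $ k) * (\<Sum>(j, l)\<in>?E. y $ j * y $ l)"
    by (simp add: sum_product case_prod_beta mult_ac)
  ultimately show ?thesis
    unfolding sym_biquad_def biquad_of_sums_def
    by (simp add: sum_product[symmetric] sum_off_diagonal_products mult.assoc)
qed

text \<open>
  Bilinear interpolation in \<open>s\<close> and \<open>t\<close> from the corners of \<open>[0, m X] \<times> [0, n Y]\<close>, cleared of
  denominators so that it also covers \<open>X = 0\<close> and \<open>Y = 0\<close>.
\<close>

lemma biquad_of_sums_interpolation:
  "m * n * biquad_of_sums a b c X s Y t =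
      (m * X - s) * (n * Y - t) * (1 - a - b + c)
    + s * (n * Y - t) * (1 - b + (m - 1) * (a - c))
    + (m * X - s) * t * (1 - a + (n - 1) * (b - c))
    + s * t * (1 + (m - 1) * a + (n - 1) * b + (m - 1) * (n - 1) * c)"
  unfolding biquad_of_sums_def by algebra

lemma biquad_of_sums_nonneg:
  assumes "0 \<le> 1 - b + (m - 1) * (a - c)"
    and "0 \<le> 1 - a + (n - 1) * (b - c)"
    and "0 \<le> 1 - a - b + c"
    and "0 \<le> 1 + (m - 1) * a + (n - 1) * b + (m - 1) * (n - 1) * c"
    and "0 < m" "0 < n" "0 \<le> s" "s \<le> m * X" "0 \<le> t" "t \<le> n * Y"
  shows "0 \<le> biquad_of_sums a b c X s Y t"
proof -
  have "0 \<le> m * X - s" "0 \<le> n * Y - t"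
    using assms by simp_all
  have "0 \<le> m * n * biquad_of_sums a b c X s Y t"
    unfolding biquad_of_sums_interpolation
    by (fact | rule add_nonneg_nonneg mult_nonneg_nonneg)+
  moreover have "0 < m * n"
    using \<open>0 < m\<close> \<open>0 < n\<close> by simp
  ultimately show ?thesis
    by (metis zero_le_mult_iff not_less)
qed

lemma square_sum_le_card_mult_sum_squares:
  fixes x :: "real ^ 'm"
  shows "(\<Sum>i\<in>UNIV. x $ i)\<^sup>2 \<le> real CARD('m) * (\<Sum>i\<in>UNIV. (x $ i)\<^sup>2)"
  using sum_squared_le_sum_of_squares[of "\<lambda>i. x $ i" "UNIV :: 'm set"] by (simp add: mult.commute)

lemma exists_vector_with_sum_zero:
  assumes "2 \<le> CARD('m)"
  shows "\<exists>x :: real ^ 'm. (\<Sum>i\<in>UNIV. (x $ i)\<^sup>2) = 2 \<and> (\<Sum>i\<in>UNIV. x $ i) = 0"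
proof -
  obtain p q :: 'm where "p \<noteq> q"
    using assms by (metis UNIV_I card_2_iff' card_le_Suc0_iff_eq finite not_less_eq_eq numeral_2_eq_2)
  define x :: "real ^ 'm" where "x = (\<chi> i. (if i = p then 1 else 0) - (if i = q then 1 else 0))"
  have "(\<Sum>i\<in>UNIV. x $ i) = 0"
    by (simp add: x_def sum_subtractf)
  moreover have "(x $ i)\<^sup>2 = (if i = p then 1 else 0) + (if i = q then 1 else 0)" for i
    using \<open>p \<noteq> q\<close> by (simp add: x_def)
  then have "(\<Sum>i\<in>UNIV. (x $ i)\<^sup>2) = 2"
    by (simp add: sum.distrib)
  ultimately show ?thesis by blast
qed

theorem theorem4p2:
  fixes a b c :: real and m n :: nat
    and P :: "real ^ 'm \<Rightarrow> real ^ 'n \<Rightarrow> real"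
  assumes "m = CARD('m)" and "n = CARD('n)" and "m \<ge> 2" and "n \<ge> 2"
    and "P = sym_biquad a b c"
  shows "psd P \<longleftrightarrow>
      1 - b + (real m - 1) * (a - c) \<ge> 0
    \<and> 1 - a + (real n - 1) * (b - c) \<ge> 0
    \<and> 1 - a - b + c \<ge> 0
    \<and> 1 + (real m - 1) * a + (real n - 1) * b + (real m - 1) * (real n - 1) * c \<ge> 0
    \<and> (c \<noteq> 0 \<and> a / c \<in> {1 - real n..<1} \<and> b / c \<in> {1 - real m..<1} \<longrightarrow> 1 - a * b / c \<ge> 0)"
    (is "_ \<longleftrightarrow> ?i \<and> ?ii \<and> ?iii \<and> ?iv \<and> ?v")
proof -
  have pos: "0 < real m" "0 < real n"
    using \<open>m \<ge> 2\<close> \<open>n \<ge> 2\<close> by auto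
  have P_eq: "P x y = biquad_of_sums a b c (\<Sum>i\<in>UNIV. (x $ i)\<^sup>2) ((\<Sum>i\<in>UNIV. x $ i)\<^sup>2)
      (\<Sum>j\<in>UNIV. (y $ j)\<^sup>2) ((\<Sum>j\<in>UNIV. y $ j)\<^sup>2)" for x y
    using \<open>P = _\<close> by (simp add: sym_biquad_eq_biquad_of_sums)
  have corners: "?i \<and> ?ii \<and> ?iii \<and> ?iv" if "psd P"
  proof -
    define ux :: "real ^ 'm" where "ux = (\<chi> i. 1)"
    define uy :: "real ^ 'n" where "uy = (\<chi> j. 1)"
    obtain zx :: "real ^ 'm" where zx: "(\<Sum>i\<in>UNIV. (zx $ i)\<^sup>2) = 2" "(\<Sum>i\<in>UNIV. zx $ i) = 0"
      using exists_vector_with_sum_zero[where 'm = 'm] assms by auto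
    obtain zy :: "real ^ 'n" where zy: "(\<Sum>j\<in>UNIV. (zy $ j)\<^sup>2) = 2" "(\<Sum>j\<in>UNIV. zy $ j) = 0"
      using exists_vector_with_sum_zero[where 'm = 'n] assms by auto
    have ux: "(\<Sum>i\<in>UNIV. (ux $ i)\<^sup>2) = real m" "(\<Sum>i\<in>UNIV. ux $ i) = real m"
      and uy: "(\<Sum>j\<in>UNIV. (uy $ j)\<^sup>2) = real n" "(\<Sum>j\<in>UNIV. uy $ j) = real n"
      using assms by (simp_all add: ux_def uy_def)
    have "P ux zy = 2 * real m * (1 - b + (real m - 1) * (a - c))"
      and "P zx uy = 2 * real n * (1 - a + (real n - 1) * (b - c))"
      and "P zx zy = 4 * (1 - a - b + c)"
      and "P ux uy = real m * real n *
        (1 + (real m - 1) * a + (real n - 1) * b + (real m - 1) * (real n - 1) * c)"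
      unfolding P_eq ux uy zx zy biquad_of_sums_def
      by (simp_all add: power2_eq_square algebra_simps)
    moreover have "0 \<le> P ux zy" "0 \<le> P zx uy" "0 \<le> P zx zy" "0 \<le> P ux uy"
      using that by (simp_all add: psd_def)
    ultimately show ?thesis
      using pos mult_pos_pos[OF pos] by (simp add: zero_le_mult_iff not_le)
  qed
  have "?v" if "?i" "?ii" "?iii" "?iv"
  proof
    assume v: "c \<noteq> 0 \<and> a / c \<in> {1 - real n..<1} \<and> b / c \<in> {1 - real m..<1}"
    \<comment> \<open>The critical point; membership in (v) puts it in the rectangle for \<open>X = Y = 1\<close>.\<close>
    have "0 \<le> biquad_of_sums a b c 1 (1 - b / c) 1 (1 - a / c)"
      using biquad_of_sums_nonneg[OF that pos] v by simp
    also have "biquad_of_sums a b c 1 (1 - b / c) 1 (1 - a / c) = 1 - a * b / c"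
      using v by (simp add: biquad_of_sums_def field_simps)
    finally show "1 - a * b / c \<ge> 0" .
  qed
  moreover have "psd P" if "?i" "?ii" "?iii" "?iv"
    unfolding psd_def P_eq
    by (intro allI biquad_of_sums_nonneg[OF that pos])
      (use assms(1,2) in \<open>simp_all add: square_sum_le_card_mult_sum_squares\<close>)
  ultimately show ?thesis
    using corners by blast
qed

end
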